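(* Let $m\ge 0$ be an integer and let $L$ be a Latin square of order $4m+2$. Then either $L$ has no transversal or $L$ has no maximal partial transversal of length $2m+1$. In particular, $L$ is not omniversal.
   Context: A Latin square of order $n$ is an $n\times n$ array on $n$ symbols in which each row and each column contains each symbol exactly once; it is viewed as a set of triples $(r,c,s)$. A partial transversal is a set of triples containing at most one triple in each row, at most one in each column, and at most one with each symbol; its length is its number of triples. It is maximal if not contained in a longer partial transversal. A transversal is a partial transversal of length $n$. A Latin square of order $n$ is omniversal if it has a maximal partial transversal of every length $\ell$ with $\lceil n/2\rceil\le\ell\le n$. *)

theory Defs
  imports Complex_Main
begin

text \<open>
  An array is a function \<open>A\<close> of a row and a column; rows, columns and symbols are drawn from
  arbitrary \<open>n\<close>-element sets. The values of \<open>A\<close> outside \<open>R \<times> C\<close> are irrelevant. Finiteness is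
  stated separately because \<open>card\<close> is \<open>0\<close> on infinite sets.
\<close>

definition latin_square ::
    "nat \<Rightarrow> 'r set \<Rightarrow> 'c set \<Rightarrow> 's set \<Rightarrow> ('r \<Rightarrow> 'c \<Rightarrow> 's) \<Rightarrow> bool" where
  "latin_square n R C S A \<longleftrightarrow>
     finite R \<and> card R = n \<and> finite C \<and> card C = n \<and> finite S \<and> card S = n \<and>
     (\<forall>r\<in>R. \<forall>c\<in>C. A r c \<in> S) \<and>
     (\<forall>r\<in>R. \<forall>s\<in>S. \<exists>!c. c \<in> C \<and> A r c = s) \<and>
     (\<forall>c\<in>C. \<forall>s\<in>S. \<exists>!r. r \<in> R \<and> A r c = s)"

definition triples :: "'r set \<Rightarrow> 'c set \<Rightarrow> ('r \<Rightarrow> 'c \<Rightarrow> 's) \<Rightarrow> ('r \<times> 'c \<times> 's) set" where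
  "triples R C A = {(r, c, A r c) | r c. r \<in> R \<and> c \<in> C}"

text \<open>Injectivity of a coordinate on \<open>T\<close> says that at most one triple of \<open>T\<close> has each value
  of that coordinate.\<close>

definition partial_transversal ::
    "('r \<times> 'c \<times> 's) set \<Rightarrow> ('r \<times> 'c \<times> 's) set \<Rightarrow> bool" where
  "partial_transversal L T \<longleftrightarrow>
     T \<subseteq> L \<and>
     inj_on (\<lambda>(r, c, s). r) T \<and> inj_on (\<lambda>(r, c, s). c) T \<and> inj_on (\<lambda>(r, c, s). s) T"

definition maximal_partial_transversal ::
    "('r \<times> 'c \<times> 's) set \<Rightarrow> ('r \<times> 'c \<times> 's) set \<Rightarrow> bool" where
  "maximal_partial_transversal L T \<longleftrightarrow>
     partial_transversal L T \<and>
     \<not> (\<exists>T'. partial_transversal L T' \<and> T \<subseteq> T' \<and> card T < card T')"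

definition transversal ::
    "nat \<Rightarrow> ('r \<times> 'c \<times> 's) set \<Rightarrow> ('r \<times> 'c \<times> 's) set \<Rightarrow> bool" where
  "transversal n L T \<longleftrightarrow> partial_transversal L T \<and> card T = n"

definition omniversal :: "nat \<Rightarrow> ('r \<times> 'c \<times> 's) set \<Rightarrow> bool" where
  "omniversal n L \<longleftrightarrow>
     (\<forall>l::nat. \<lceil>real n / 2\<rceil> \<le> int l \<and> l \<le> n \<longrightarrow>
        (\<exists>T. maximal_partial_transversal L T \<and> card T = l))"

end

theory Submission
  imports Defs
begin

text \<open>
  Let \<open>k = 2 * m + 1\<close> and let \<open>P\<close> be maximal of length \<open>k\<close>. By maximality, the \<open>k \<times> k\<close> subarray on
  the rows and columns that \<open>P\<close> misses only contains the \<open>k\<close> symbols of \<open>P\<close>, so it is a Latin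
  subsquare, and the whole square splits into four subsquares of order \<open>k\<close>. Consequently every
  triple has an even number of coordinates missed by \<open>P\<close>. A transversal meets every row, column
  and symbol once, so its triples have \<open>3 * k\<close> coordinates missed by \<open>P\<close> in total, which is odd.
\<close>

text \<open>Counting makes \<open>f\<close> map \<open>X\<close> onto all of \<open>Y\<close>, so by
  injectivity no element of \<open>C\<close> outside \<open>X\<close> can reach
  \<open>Y\<close>.\<close>

lemma inj_on_mem_iff_of_card_eq:
  assumes "inj_on f C" "X \<subseteq> C" "f ` X \<subseteq> Y" "card X = card Y" "finite Y" "c \<in> C"
  shows "f c \<in> Y \<longleftrightarrow> c \<in> X"
proof -
  have "card (f ` X) = card Y"
    using assms by (metis card_image inj_on_subset)
  then have "f ` X = Y"
    using assms by (simp add: card_subset_eq)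
  then show ?thesis
    using assms by (metis inj_on_image_mem_iff)
qed

lemma bij_betw_of_card_eq:
  assumes "finite B" "inj_on f A" "f ` A \<subseteq> B" "card A = card B"
  shows "bij_betw f A B"
  using assms by (simp add: bij_betw_def card_image card_subset_eq)

lemma sum_of_bool_bij_betw:
  assumes "bij_betw f T R" "X \<subseteq> R" "finite R"
  shows "(\<Sum>t\<in>T. of_bool (f t \<in> X)) = card X"
proof -
  have "(\<Sum>t\<in>T. of_bool (f t \<in> X)) = (\<Sum>r\<in>R. of_bool (r \<in> X) :: nat)"
    by (rule sum.reindex_bij_betw[OF assms(1)])
  also have "\<dots> = card X"
    using assms by (simp add: Int_absorb1)
  finally show ?thesis .
qed

lemma finite_triples:
  assumes "finite R" "finite C"
  shows "finite (triples R C A)"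
proof -
  have "triples R C A = (\<lambda>(r, c). (r, c, A r c)) ` (R \<times> C)"
    by (auto simp: triples_def)
  then show ?thesis
    using assms by simp
qed

text \<open>Otherwise the triple could be added to \<open>P\<close>. Maximality compares
  cardinalities, and finiteness of \<open>L\<close> ensures that this insertion increases the
  cardinality.\<close>

lemma maximal_partial_transversal_symbol_mem:
  assumes max: "maximal_partial_transversal L P" and "finite L" "(r, c, s) \<in> L"
    and "r \<notin> (\<lambda>(r, c, s). r) ` P" "c \<notin> (\<lambda>(r, c, s). c) ` P"
  shows "s \<in> (\<lambda>(r, c, s). s) ` P"
proof (rule ccontr)
  assume s: "s \<notin> (\<lambda>(r, c, s). s) ` P"
  let ?P' = "insert (r, c, s) P"
  have P: "partial_transversal L P"
    using max by (simp add: maximal_partial_transversal_def)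
  then have "finite P"
    using \<open>finite L\<close> finite_subset by (auto simp: partial_transversal_def)
  moreover have new: "(r, c, s) \<notin> P"
    using s by force
  ultimately have "card P < card ?P'"
    by simp
  moreover have "partial_transversal L ?P'"
    using P assms s new by (simp add: partial_transversal_def)
  ultimately show False
    using max unfolding maximal_partial_transversal_def by blast
qed

lemma inj_on_latin_square_row:
  assumes "latin_square n R C S A" "r \<in> R"
  shows "inj_on (A r) C"
  using assms unfolding latin_square_def inj_on_def by metis

lemma inj_on_latin_square_column:
  assumes "latin_square n R C S A" "c \<in> C"
  shows "inj_on (\<lambda>r. A r c) R"
  using assms unfolding latin_square_def inj_on_def by metis

text \<open>The equivalence is a parity statement: of \<open>r \<in> R'\<close>,
  \<open>c \<in> C'\<close> and \<open>A r c \<in> S'\<close>, either none or exactly two hold. It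
  comes from filling the four \<open>k \<times> k\<close> blocks one after another, starting at
  \<open>R' \<times> C'\<close>.\<close>

lemma latin_square_quadrants:
  assumes L: "latin_square (2 * k) R C S A"
    and sub: "R' \<subseteq> R" "C' \<subseteq> C" "S' \<subseteq> S"
    and card: "card R' = k" "card C' = k" "card S' = k"
    and closed: "\<And>r c. r \<in> R' \<Longrightarrow> c \<in> C' \<Longrightarrow> A r c \<notin> S'"
    and rc: "r \<in> R" "c \<in> C"
  shows "A r c \<in> S' \<longleftrightarrow> (r \<in> R' \<longleftrightarrow> c \<notin> C')"
proof -
  have fin: "finite S" "finite S'" "card (S - S') = k"
    using L sub card by (auto simp: latin_square_def card_Diff_subset finite_subset)
  have mem: "A x y \<in> S" if "x \<in> R" "y \<in> C" for x y
    using L that by (simp add: latin_square_def)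
  \<comment> \<open>The \<open>k\<close> cells of row \<open>x\<close> in the columns
    \<open>C'\<close> already use up the \<open>k\<close> symbols of \<open>S - S'\<close>; the
    columns below are symmetric.\<close>
  have missed_row: "A x y \<in> S - S' \<longleftrightarrow> y \<in> C'" if "x \<in> R'" "y \<in> C" for x y
    using inj_on_latin_square_row[OF L, of x] that sub card fin closed mem
    by (intro inj_on_mem_iff_of_card_eq[of "A x" C]) (auto simp: subset_iff)
  have missed_col: "A x y \<in> S - S' \<longleftrightarrow> x \<in> R'" if "x \<in> R" "y \<in> C'" for x y
    using inj_on_latin_square_column[OF L, of y] that sub card fin closed mem
    by (intro inj_on_mem_iff_of_card_eq[of "\<lambda>x. A x y" R]) (auto simp: subset_iff)
  show ?thesis
  proof (cases "r \<in> R'")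
    case True
    then show ?thesis
      using missed_row[of r c] mem rc by auto
  next
    case False
    \<comment> \<open>In each column of \<open>C'\<close> the symbols of \<open>S - S'\<close> all
      lie in rows of \<open>R'\<close>, so row \<open>r\<close> has only symbols of
      \<open>S'\<close> there, and by counting it has all of them.\<close>
    then have "A r ` C' \<subseteq> S'"
      using missed_col rc sub mem by blast
    then have "A r c \<in> S' \<longleftrightarrow> c \<in> C'"
      using inj_on_latin_square_row[OF L, of r] rc sub card fin
      by (intro inj_on_mem_iff_of_card_eq[of "A r" C]) auto
    then show ?thesis
      using False by simp
  qed
qed

lemma even_if_transversal_and_maximal_half:
  assumes L: "latin_square (2 * k) R C S A"
    and T: "transversal (2 * k) (triples R C A) T"
    and P: "maximal_partial_transversal (triples R C A) P" "card P = k"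
  shows "even k"
proof -
  let ?row = "\<lambda>(r, c, s). r" and ?col = "\<lambda>(r, c, s). c" and ?sym = "\<lambda>(r, c, s). s"
  define R' C' S' where "R' = R - ?row ` P" and "C' = C - ?col ` P" and "S' = S - ?sym ` P"
  have fin: "finite R" "finite C" "finite S"
    and card: "card R = 2 * k" "card C = 2 * k" "card S = 2 * k"
    and mem: "\<And>r c. r \<in> R \<Longrightarrow> c \<in> C \<Longrightarrow> A r c \<in> S"
    using L by (auto simp: latin_square_def)
  have img: "?row ` Q \<subseteq> R" "?col ` Q \<subseteq> C" "?sym ` Q \<subseteq> S" if "Q \<subseteq> triples R C A" for Q
    using that mem by (auto simp: triples_def)
  have P': "P \<subseteq> triples R C A" "inj_on ?row P" "inj_on ?col P" "inj_on ?sym P"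
    using P by (auto simp: maximal_partial_transversal_def partial_transversal_def)
  have T': "T \<subseteq> triples R C A" "inj_on ?row T" "inj_on ?col T" "inj_on ?sym T" "card T = 2 * k"
    using T by (auto simp: transversal_def partial_transversal_def)
  have sub: "R' \<subseteq> R" "C' \<subseteq> C" "S' \<subseteq> S"
    by (auto simp: R'_def C'_def S'_def)
  have "card R' = card R - card (?row ` P)"
    unfolding R'_def using img[OF P'(1)] fin by (intro card_Diff_subset) (auto intro: finite_subset)
  moreover have "card C' = card C - card (?col ` P)"
    unfolding C'_def using img[OF P'(1)] fin by (intro card_Diff_subset) (auto intro: finite_subset)
  moreover have "card S' = card S - card (?sym ` P)"
    unfolding S'_def using img[OF P'(1)] fin by (intro card_Diff_subset) (auto intro: finite_subset)
  ultimately have card': "card R' = k" "card C' = k" "card S' = k"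
    using P' P(2) card by (simp_all add: card_image)
  have "A r c \<notin> S'" if "r \<in> R'" "c \<in> C'" for r c
  proof -
    have "(r, c, A r c) \<in> triples R C A"
      using that sub by (auto simp: triples_def)
    then show ?thesis
      using maximal_partial_transversal_symbol_mem[OF P(1) finite_triples[OF fin(1,2)]] that
      by (simp add: R'_def C'_def S'_def)
  qed
  note quad = latin_square_quadrants[OF L sub card' this]
  \<comment> \<open>By \<open>quad\<close> the three indicators add up to 0 or 2.\<close>
  have "even (of_bool (?row t \<in> R') + of_bool (?col t \<in> C') + of_bool (?sym t \<in> S') :: nat)"
    if t: "t \<in> T" for t
  proof -
    obtain r c where "t = (r, c, A r c)" "r \<in> R" "c \<in> C"
      using t T'(1) by (auto simp: triples_def)
    then show ?thesis
      using quad[of r c] by auto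
  qed
  then have "even (\<Sum>t\<in>T. of_bool (?row t \<in> R') + of_bool (?col t \<in> C') + of_bool (?sym t \<in> S') :: nat)"
    by (rule dvd_sum)
  \<comment> \<open>Having length \<open>2 * k\<close>, \<open>T\<close> meets every row, column and
    symbol exactly once, so each of the three sums counts a set of size \<open>k\<close>.\<close>
  moreover have "bij_betw ?row T R" "bij_betw ?col T C" "bij_betw ?sym T S"
    using T' img[OF T'(1)] fin card by (simp_all add: bij_betw_of_card_eq)
  then have "(\<Sum>t\<in>T. of_bool (?row t \<in> R')) = k" "(\<Sum>t\<in>T. of_bool (?col t \<in> C')) = k"
      "(\<Sum>t\<in>T. of_bool (?sym t \<in> S')) = k"
    using sum_of_bool_bij_betw[of ?row T R R'] sum_of_bool_bij_betw[of ?col T C C']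
      sum_of_bool_bij_betw[of ?sym T S S'] sub fin card' by metis+
  ultimately have "even (k + k + k)"
    by (simp only: sum.distrib)
  then show ?thesis
    by simp
qed

theorem theorem2p1:
  fixes m :: nat
    and R :: "'r set" and C :: "'c set" and S :: "'s set"
    and A :: "'r \<Rightarrow> 'c \<Rightarrow> 's" and L :: "('r \<times> 'c \<times> 's) set"
  assumes "latin_square (4 * m + 2) R C S A"
    and "L = triples R C A"
  shows "((\<nexists>T. transversal (4 * m + 2) L T) \<or>
          (\<nexists>T. maximal_partial_transversal L T \<and> card T = 2 * m + 1)) \<and>
         \<not> omniversal (4 * m + 2) L"
proof -
  have n: "4 * m + 2 = 2 * (2 * m + 1)"
    by simp
  have no_both: "\<not> (transversal (4 * m + 2) L T \<and> maximal_partial_transversal L P \<and> card P = 2 * m + 1)"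
    for T P
  proof
    assume "transversal (4 * m + 2) L T \<and> maximal_partial_transversal L P \<and> card P = 2 * m + 1"
    then have "even (2 * m + 1)"
      using even_if_transversal_and_maximal_half[of "2 * m + 1" R C S A T P] assms
      unfolding n by blast
    then show False
      by simp
  qed
  have "\<not> omniversal (4 * m + 2) L"
  proof
    assume omni: "omniversal (4 * m + 2) L"
    \<comment> \<open>The order is even, so the lower end of the range of lengths is exactly
      \<open>2 * m + 1\<close>. Only the two ends of the range are used: the upper one supplies a
      transversal, the lower one a maximal partial transversal of half length.\<close>
    have half: "\<lceil>real (4 * m + 2) / 2\<rceil> = int (2 * m + 1)"
      by (simp add: ceiling_unique)
    obtain T where "maximal_partial_transversal L T" "card T = 4 * m + 2"
      using omni[unfolded omniversal_def half, rule_format, of "4 * m + 2"] by auto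
    then have "transversal (4 * m + 2) L T"
      by (simp add: transversal_def maximal_partial_transversal_def)
    moreover obtain P where "maximal_partial_transversal L P" "card P = 2 * m + 1"
      using omni[unfolded omniversal_def half, rule_format, of "2 * m + 1"] by auto
    ultimately show False
      using no_both by blast
  qed
  then show ?thesis
    using no_both by blast
qed

end
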